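(* There exists a request sequence $\sigma$ on a uniform metric such that under LRU, one server incurs cost $\Omega(\mathrm{cost}(\mathrm{LRU},\sigma))$ while all other servers incur only $O(1)$ cost. Consequently, LRU does not satisfy $(\alpha,\beta)$-fairness with respect to its own total cost for any $\alpha=o(k)$ and any $\beta=o(\mathrm{cost}(\mathrm{LRU},\sigma))$.
   Context: $k$-server problem on a uniform metric (all distinct points at distance $1$), equivalently paging: $k$ servers (cache slots) occupy points (pages); on a request to a point with no server (a fault), some server must move there at cost $1$. $c_i$ is the cost of server $i$, $\mathrm{cost}=\sum_i c_i$. LRU (Least Recently Used), on a fault, moves the server whose current page was least recently requested. An algorithm is $(\alpha,\beta)$-fair with respect to its own cost if for all request sequences each server satisfies $c_i\le \alpha\,\mathrm{cost}/k+\beta$. Asymptotic notation refers to the sequence length (and hence $\mathrm{cost}(\mathrm{LRU},\sigma)$) growing, with $k$ fixed. *)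

theory Defs
  imports "HOL-Analysis.Abstract_Metric_Spaces" "HOL-Library.Landau_Symbols"
begin

definition uniform_metric :: "'p set \<Rightarrow> ('p \<Rightarrow> 'p \<Rightarrow> real) \<Rightarrow> bool" where
  "uniform_metric P d \<longleftrightarrow> Metric_space P d \<and> (\<forall>x\<in>P. \<forall>y\<in>P. x \<noteq> y \<longrightarrow> d x y = 1)"

text \<open>
  The servers are numbered \<open>0, \<dots>, k - 1\<close>. A (deterministic, online) algorithm maps the
  list of requests seen so far, oldest first, to the resulting configuration: \<open>A \<sigma> i\<close> is the
  point occupied by server \<open>i\<close> once \<open>\<sigma>\<close> has been served, and \<open>A []\<close> is the initial
  configuration.
\<close>

type_synonym 'p algorithm = "'p list \<Rightarrow> nat \<Rightarrow> 'p"

definition server_cost :: "('p \<Rightarrow> 'p \<Rightarrow> real) \<Rightarrow> 'p algorithm \<Rightarrow> nat \<Rightarrow> 'p list \<Rightarrow> real" where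
  "server_cost d A i \<sigma> = (\<Sum>t<length \<sigma>. d (A (take t \<sigma>) i) (A (take (Suc t) \<sigma>) i))"

definition total_cost :: "nat \<Rightarrow> ('p \<Rightarrow> 'p \<Rightarrow> real) \<Rightarrow> 'p algorithm \<Rightarrow> 'p list \<Rightarrow> real" where
  "total_cost k d A \<sigma> = (\<Sum>i<k. server_cost d A i \<sigma>)"

text \<open>
  Time of the last request to \<open>p\<close>, counted from 1. The value 0 means that \<open>p\<close> was never
  requested, so unrequested initial points are the least recently used ones.
\<close>

definition last_request :: "'p list \<Rightarrow> 'p \<Rightarrow> nat" where
  "last_request \<sigma> p = Max (insert 0 {Suc t |t. t < length \<sigma> \<and> \<sigma> ! t = p})"

text \<open>
  Ties can only occur between initial points that were never requested; they may be broken
  arbitrarily, so \<open>is_LRU\<close> is a predicate. The servers start at distinct points.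
\<close>

definition is_LRU :: "nat \<Rightarrow> 'p set \<Rightarrow> 'p algorithm \<Rightarrow> bool" where
  "is_LRU k P A \<longleftrightarrow>
     inj_on (A []) {..<k} \<and> A [] ` {..<k} \<subseteq> P \<and>
     (\<forall>\<sigma>\<in>lists P. \<forall>r\<in>P.
        if r \<in> A \<sigma> ` {..<k}
        then \<forall>j<k. A (\<sigma> @ [r]) j = A \<sigma> j
        else \<exists>i<k. (\<forall>j<k. last_request \<sigma> (A \<sigma> i) \<le> last_request \<sigma> (A \<sigma> j)) \<and>
                   A (\<sigma> @ [r]) i = r \<and> (\<forall>j<k. j \<noteq> i \<longrightarrow> A (\<sigma> @ [r]) j = A \<sigma> j))"

text \<open>
  The additive term may depend on the request sequence, so that bounds such as
  \<open>\<beta> = o(cost)\<close> can be expressed; a constant \<open>b\<close> is the special case \<open>\<lambda>_. b\<close>.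
\<close>

definition fair ::
  "nat \<Rightarrow> 'p set \<Rightarrow> ('p \<Rightarrow> 'p \<Rightarrow> real) \<Rightarrow> 'p algorithm \<Rightarrow> real \<Rightarrow> ('p list \<Rightarrow> real) \<Rightarrow> bool" where
  "fair k P d A \<alpha> \<beta> \<longleftrightarrow>
     (\<forall>\<sigma>\<in>lists P. \<forall>i<k. server_cost d A i \<sigma> \<le> \<alpha> * total_cost k d A \<sigma> / real k + \<beta> \<sigma>)"

text \<open>Request sequences over \<open>P\<close> whose total cost under \<open>A\<close> tends to infinity.\<close>

definition growing_cost ::
  "nat \<Rightarrow> 'p set \<Rightarrow> ('p \<Rightarrow> 'p \<Rightarrow> real) \<Rightarrow> 'p algorithm \<Rightarrow> 'p list filter" where
  "growing_cost k P d A = inf (filtercomap (total_cost k d A) at_top) (principal (lists P))"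

text \<open>The predicate \<open>is_LRU\<close> is satisfiable from every admissible initial configuration.\<close>

lemma ex_is_LRU:
  fixes s :: "nat \<Rightarrow> 'p"
  assumes k: "0 < k" and s: "inj_on s {..<k}" "s ` {..<k} \<subseteq> P"
  shows "\<exists>A. A [] = s \<and> is_LRU k P A"
proof -
  define victim where
    "victim \<sigma> c = (SOME i. i < k \<and> (\<forall>j<k. last_request \<sigma> (c i) \<le> last_request \<sigma> (c j)))"
    for \<sigma> and c :: "nat \<Rightarrow> 'p"
  have victim: "victim \<sigma> c < k \<and>
      (\<forall>j<k. last_request \<sigma> (c (victim \<sigma> c)) \<le> last_request \<sigma> (c j))" for \<sigma> c
  proof -
    have "\<exists>i. i < k \<and> (\<forall>j. j < k \<longrightarrow> last_request \<sigma> (c i) \<le> last_request \<sigma> (c j))"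
      using ex_has_least_nat[of "\<lambda>i. i < k" 0 "\<lambda>i. last_request \<sigma> (c i)"] k by blast
    then show ?thesis unfolding victim_def by (rule someI_ex)
  qed
  define B where
    "B = rec_list s (\<lambda>r \<sigma> c. if r \<in> c ` {..<k} then c else c(victim (rev \<sigma>) c := r))"
  define A where "A \<sigma> = B (rev \<sigma>)" for \<sigma>
  have Nil: "A [] = s"
    by (simp add: A_def B_def)
  have snoc: "A (\<sigma> @ [r]) =
      (if r \<in> A \<sigma> ` {..<k} then A \<sigma> else (A \<sigma>)(victim \<sigma> (A \<sigma>) := r))" for \<sigma> r
    by (simp add: A_def B_def)
  have "is_LRU k P A"
    unfolding is_LRU_def Nil snoc using s victim by (auto simp: Nil)
  with Nil show ?thesis by blast
qed

end

theory Submission imports Defs begin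

text \<open>
  Let the servers start at \<open>a 0, \<dots>, a (k - 1)\<close> and let \<open>b\<close> be one further point. Each round of
  \<open>k\<close> requests first touches \<open>a 1, \<dots>, a (k - 1)\<close>, all of them hits, so that the page of
  server 0 becomes the least recently used one; the round ends with a request to whichever of
  \<open>b\<close>, \<open>a 0\<close> is uncovered. Thus server 0 alternates between \<open>a 0\<close> and \<open>b\<close>, moving once per
  round, and no other server ever moves. Server 0 pays the whole cost, which rules out
  fairness with \<open>\<alpha> / k\<close> bounded away from 1.
\<close>

text \<open>\<open>n\<close> counts the requests served, so \<open>n div k\<close> is the number of
  completed rounds, and its parity decides where server 0 stands.\<close>

definition shuttle_config :: "nat \<Rightarrow> (nat \<Rightarrow> 'p) \<Rightarrow> 'p \<Rightarrow> nat \<Rightarrow> nat \<Rightarrow> 'p" where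
  "shuttle_config k a b n j = (if j = 0 \<and> odd (n div k) then b else a j)"

text \<open>Each request is read off the configuration it should produce. Index
  \<open>Suc t mod k = 0\<close> falls at the end of a round, so one formula covers both the hits
  and the closing fault.\<close>

definition shuttle_request :: "nat \<Rightarrow> (nat \<Rightarrow> 'p) \<Rightarrow> 'p \<Rightarrow> nat \<Rightarrow> 'p" where
  "shuttle_request k a b t = shuttle_config k a b (Suc t) (Suc t mod k)"

lemma shuttle_config_Suc:
  "Suc n mod k \<noteq> 0 \<or> j \<noteq> 0 \<Longrightarrow> shuttle_config k a b (Suc n) j = shuttle_config k a b n j"
  by (auto simp: shuttle_config_def div_Suc)

text \<open>All of \<open>a 0\<close>, ..., \<open>a (k - 1)\<close> and \<open>b\<close> are
  distinct. The times \<open>m\<close> and \<open>n\<close> are independent so that past requests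
  can be compared with the present configuration.\<close>

lemma shuttle_config_inj:
  assumes "inj_on a {..<k}" and "b \<notin> a ` {..<k}" and "i < k" and "j < k"
  shows "shuttle_config k a b m i = shuttle_config k a b n j \<longleftrightarrow>
    i = j \<and> (i = 0 \<longrightarrow> even (m div k) = even (n div k))"
proof -
  have "b \<noteq> a i" "b \<noteq> a j" using assms by auto
  then show ?thesis
    using inj_on_eq_iff[OF assms(1)] assms(3,4) by (auto simp: shuttle_config_def)
qed

lemma last_request_ge: "t < length \<sigma> \<Longrightarrow> \<sigma> ! t = p \<Longrightarrow> Suc t \<le> last_request \<sigma> p"
  unfolding last_request_def by (rule Max_ge) auto

lemma last_request_le:
  "(\<And>t. t < length \<sigma> \<Longrightarrow> \<sigma> ! t = p \<Longrightarrow> Suc t \<le> m) \<Longrightarrow> last_request \<sigma> p \<le> m"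
  unfolding last_request_def by (rule Max.boundedI) auto

text \<open>Just before a round closes, each server \<open>j > 0\<close> has had its page requested
  within that round, whereas the page of server 0 can only have been requested at the end of an
  earlier one, if at all. Strictness makes the LRU victim unique, however ties are broken.\<close>

lemma last_request_shuttle_less:
  fixes a :: "nat \<Rightarrow> 'p"
  assumes a: "inj_on a {..<k}" and b: "b \<notin> a ` {..<k}"
    and n: "Suc n mod k = 0" and j: "0 < j" "j < k"
  defines "\<sigma> \<equiv> map (shuttle_request k a b) [0..<n]"
  shows "last_request \<sigma> (shuttle_config k a b n 0) < last_request \<sigma> (shuttle_config k a b n j)"
proof -
  have k: "0 < k" using j by simp
  define m where "m = n div k"
  have Suc_n: "Suc n = m * k + k"
    using n div_mult_mod_eq[of "Suc n" k] by (simp add: m_def div_Suc)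
  \<comment> \<open>List positions start at 0 but \<open>last_request\<close> counts from 1;
    \<open>j > 0\<close> makes the subtraction exact.\<close>
  have t_j: "m * k + j - 1 < n" "Suc (m * k + j - 1) = m * k + j"
    using j Suc_n by auto
  have "\<sigma> ! (m * k + j - 1) = shuttle_config k a b n j"
    using t_j j k by (simp add: \<sigma>_def shuttle_request_def shuttle_config_def)
  with t_j have "m * k + j \<le> last_request \<sigma> (shuttle_config k a b n j)"
    using last_request_ge[of "m * k + j - 1" \<sigma>] by (simp add: \<sigma>_def)
  moreover have "last_request \<sigma> (shuttle_config k a b n 0) \<le> m * k"
  proof (rule last_request_le)
    fix t assume t: "t < length \<sigma>" and hit: "\<sigma> ! t = shuttle_config k a b n 0"
    then have "t < n" by (simp add: \<sigma>_def)
    \<comment> \<open>A request for the page of server 0 must be one aimed at server 0, hence one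
      that closes a round.\<close>
    with hit have "Suc t mod k = 0"
      using shuttle_config_inj[OF a b, of "Suc t mod k" 0] k
      by (simp add: \<sigma>_def shuttle_request_def)
    then obtain q where q: "Suc t = q * k" by (metis mod_0_imp_dvd dvd_def mult.commute)
    have "q * k < (m + 1) * k" using \<open>t < n\<close> q Suc_n by simp
    then have "q \<le> m" by (simp only: mult_less_cancel2) simp
    then show "Suc t \<le> m * k" using q by simp
  qed
  ultimately show ?thesis using j by linarith
qed

text \<open>Induction on the number of requests: inside a round the requested point is covered and
  nothing moves; at its end the point is uncovered and LRU evicts the page of server 0.\<close>

lemma LRU_shuttle:
  fixes A :: "'p algorithm"
  assumes lru: "is_LRU k P A" and k: "0 < k" and b: "b \<in> P" "b \<notin> A [] ` {..<k}"
  defines "a \<equiv> A []"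
  assumes j: "j < k"
  shows "A (map (shuttle_request k a b) [0..<n]) j = shuttle_config k a b n j"
  using j
proof (induction n arbitrary: j)
  case 0
  then show ?case by (simp add: a_def shuttle_config_def)
next
  case (Suc n)
  define \<sigma> where "\<sigma> = map (shuttle_request k a b) [0..<n]"
  have a: "inj_on a {..<k}" "a ` {..<k} \<subseteq> P" and ba: "b \<notin> a ` {..<k}"
    using lru b by (auto simp: is_LRU_def a_def)
  have in_P: "shuttle_request k a b t \<in> P" for t
    using a(2) b(1) k by (auto simp: shuttle_request_def shuttle_config_def)
  have \<sigma>_P: "\<sigma> \<in> lists P"
    using in_P by (auto simp: \<sigma>_def)
  have IH: "A \<sigma> i = shuttle_config k a b n i" if "i < k" for i
    using Suc.IH[OF that] by (simp add: \<sigma>_def)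
  define r where "r = shuttle_request k a b n"
  have step: "if r \<in> A \<sigma> ` {..<k}
        then \<forall>j<k. A (\<sigma> @ [r]) j = A \<sigma> j
        else \<exists>i<k. (\<forall>j<k. last_request \<sigma> (A \<sigma> i) \<le> last_request \<sigma> (A \<sigma> j)) \<and>
                   A (\<sigma> @ [r]) i = r \<and> (\<forall>j<k. j \<noteq> i \<longrightarrow> A (\<sigma> @ [r]) j = A \<sigma> j)"
    using lru \<sigma>_P in_P[of n] unfolding is_LRU_def r_def by blast
  have "A (\<sigma> @ [r]) j = shuttle_config k a b (Suc n) j"
  proof (cases "Suc n mod k = 0")
    case False
    then have "r = A \<sigma> (Suc n mod k)"
      using k by (simp add: r_def shuttle_request_def IH shuttle_config_Suc)
    then have "r \<in> A \<sigma> ` {..<k}" using k by auto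
    with step Suc.prems False show ?thesis by (simp add: IH shuttle_config_Suc)
  next
    case True
    have r: "r = shuttle_config k a b (Suc n) 0"
      using True by (simp add: r_def shuttle_request_def)
    \<comment> \<open>The parity of the round number flips here, so server 0 stands at the other one
      of \<open>a 0\<close> and \<open>b\<close>.\<close>
    have "r \<noteq> A \<sigma> i" if "i < k" for i
      using that k True by (simp add: r IH shuttle_config_inj[OF a(1) ba] div_Suc)
    then have "r \<notin> A \<sigma> ` {..<k}" by auto
    with step obtain i where i: "i < k"
      "\<forall>j<k. last_request \<sigma> (A \<sigma> i) \<le> last_request \<sigma> (A \<sigma> j)"
      "A (\<sigma> @ [r]) i = r" "\<forall>j<k. j \<noteq> i \<longrightarrow> A (\<sigma> @ [r]) j = A \<sigma> j"
      by auto
    have "i = 0"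
      using last_request_shuttle_less[OF a(1) ba True _ i(1)] i(1,2) k
      by (fastforce simp: IH \<sigma>_def[symmetric])
    with i Suc.prems r show ?thesis by (cases "j = 0") (auto simp: IH shuttle_config_Suc)
  qed
  then show ?case by (simp add: \<sigma>_def r_def)
qed

text \<open>The costs are given exactly rather than up to constants: the factor 1 for server 0 is
  what refutes fairness for every \<open>\<alpha> < k\<close>.\<close>

lemma LRU_single_server_pays:
  fixes A :: "'p algorithm"
  assumes k: "0 < k" and d: "uniform_metric P d" and P: "infinite P \<or> k < card P"
    and lru: "is_LRU k P A"
  obtains \<rho> where "range \<rho> \<subseteq> P"
    "filterlim (\<lambda>n. total_cost k d A (map \<rho> [0..<n])) at_top sequentially"
    "\<And>n. server_cost d A 0 (map \<rho> [0..<n]) = total_cost k d A (map \<rho> [0..<n])"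
    "\<And>j n. 0 < j \<Longrightarrow> j < k \<Longrightarrow> server_cost d A j (map \<rho> [0..<n]) = 0"
proof -
  define a where "a = A []"
  have a: "inj_on a {..<k}" "a ` {..<k} \<subseteq> P"
    using lru by (auto simp: is_LRU_def a_def)
  \<comment> \<open>The servers start at only \<open>k\<close> points, so \<open>P\<close> has a
    spare one to serve as \<open>b\<close>.\<close>
  have "\<not> P \<subseteq> a ` {..<k}"
  proof
    assume sub: "P \<subseteq> a ` {..<k}"
    then have "card P \<le> k"
      using card_mono[OF _ sub] card_image[OF a(1)] by simp
    with P finite_subset[OF sub] show False by simp
  qed
  then obtain b where b: "b \<in> P" "b \<notin> a ` {..<k}" by blast
  define \<rho> where "\<rho> = shuttle_request k a b"
  have config_P: "shuttle_config k a b n j \<in> P" if "j < k" for n j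
    using that a(2) b(1) by (auto simp: shuttle_config_def)
  have d0: "d x x = 0" if "x \<in> P" for x
    using d that by (metis Metric_space.zero uniform_metric_def)
  have cost: "server_cost d A j (map \<rho> [0..<n]) =
      (\<Sum>t<n. d (shuttle_config k a b t j) (shuttle_config k a b (Suc t) j))" if "j < k" for j n
  proof -
    have "A (take t (map \<rho> [0..<n])) j = shuttle_config k a b t j" if "t \<le> n" for t
      using LRU_shuttle[OF lru k b(1) b(2)[unfolded a_def] \<open>j < k\<close>, of t] that
      by (simp add: take_map \<rho>_def a_def)
    then show ?thesis by (simp add: server_cost_def)
  qed
  have cost_0: "server_cost d A 0 (map \<rho> [0..<n]) = real (n div k)" for n
  proof -
    have "d (shuttle_config k a b t 0) (shuttle_config k a b (Suc t) 0) =
        (if Suc t mod k = 0 then 1 else 0)" for t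
    proof (cases "Suc t mod k = 0")
      case True
      then have "shuttle_config k a b t 0 \<noteq> shuttle_config k a b (Suc t) 0"
        using k by (simp add: shuttle_config_inj[OF a(1) b(2)] div_Suc)
      with True d config_P[OF k] show ?thesis by (simp add: uniform_metric_def)
    next
      case False
      then show ?thesis by (simp add: shuttle_config_Suc d0 config_P[OF k])
    qed
    then have "server_cost d A 0 (map \<rho> [0..<n]) = (\<Sum>t<n. if Suc t mod k = 0 then 1 else 0)"
      using cost[OF k] by simp
    \<comment> \<open>The sum counts completed rounds: \<open>n div k\<close> grows by one exactly
      at the closing requests.\<close>
    also have "\<dots> = real (n div k)"
      by (induction n) (simp_all add: div_Suc)
    finally show ?thesis .
  qed
  have cost_pos: "server_cost d A j (map \<rho> [0..<n]) = 0" if "0 < j" "j < k" for j n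
    using that by (simp add: cost shuttle_config_Suc d0 config_P)
  have total: "server_cost d A 0 (map \<rho> [0..<n]) = total_cost k d A (map \<rho> [0..<n])" for n
    using sum.mono_neutral_right[of "{..<k}" "{0}" "\<lambda>i. server_cost d A i (map \<rho> [0..<n])"]
      k cost_pos by (simp add: total_cost_def)
  have "filterlim (\<lambda>n. n div k) at_top sequentially"
    unfolding filterlim_at_top
  proof
    fix N
    show "\<forall>\<^sub>F n in sequentially. N \<le> n div k"
      using eventually_ge_at_top[of "N * k"]
      by eventually_elim (use k in \<open>simp add: less_eq_div_iff_mult_less_eq\<close>)
  qed
  then have "filterlim (\<lambda>n. total_cost k d A (map \<rho> [0..<n])) at_top sequentially"
    unfolding total[symmetric] cost_0
    by (rule filterlim_compose[OF filterlim_real_sequentially])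
  moreover have "range \<rho> \<subseteq> P"
    using config_P k by (auto simp: \<rho>_def shuttle_request_def)
  ultimately show thesis using that total cost_pos by blast
qed

text \<open>If \<open>T\<close> is the total cost, all paid by server 0, fairness would give
  \<open>(1 - \<alpha> / k) * T \<le> \<beta>\<close> along the shuttle sequence, against
  \<open>\<beta> = o(T)\<close>.\<close>

lemma LRU_not_fair:
  fixes A :: "'p algorithm"
  assumes k: "0 < k" and d: "uniform_metric P d" and P: "infinite P \<or> k < card P"
    and lru: "is_LRU k P A" and \<alpha>: "\<alpha> < real k"
    and \<beta>: "\<beta> \<in> o[growing_cost k P d A](total_cost k d A)"
  shows "\<not> fair k P d A \<alpha> \<beta>"
proof
  assume fair: "fair k P d A \<alpha> \<beta>"
  obtain \<rho> where \<rho>: "range \<rho> \<subseteq> P"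
    "filterlim (\<lambda>n. total_cost k d A (map \<rho> [0..<n])) at_top sequentially"
    "\<And>n. server_cost d A 0 (map \<rho> [0..<n]) = total_cost k d A (map \<rho> [0..<n])"
    using LRU_single_server_pays[OF k d P lru] by metis
  define T where "T n = total_cost k d A (map \<rho> [0..<n])" for n
  \<comment> \<open>Half of the gap: once \<open>\<beta>\<close> is at most \<open>c * T\<close>, a
    surplus of \<open>c * T\<close> remains.\<close>
  define c where "c = (1 - \<alpha> / real k) / 2"
  have c: "0 < c" using k \<alpha> by (simp add: c_def)
  have lists: "map \<rho> [0..<n] \<in> lists P" for n
    using \<rho>(1) by (auto simp: image_subset_iff)
  \<comment> \<open>The prefixes of the shuttle sequence are lists over \<open>P\<close> of
    unbounded cost, so the bound on \<open>\<beta>\<close> can be pulled back to them.\<close>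
  have "filterlim (\<lambda>n. map \<rho> [0..<n]) (growing_cost k P d A) sequentially"
    using \<rho>(2) lists
    by (auto simp: growing_cost_def filterlim_inf filterlim_filtercomap_iff filterlim_principal o_def)
  from landau_o.small.compose[OF \<beta> this]
  have "\<forall>\<^sub>F n in sequentially. \<bar>\<beta> (map \<rho> [0..<n])\<bar> \<le> c * \<bar>T n\<bar>"
    using landau_o.smallD[OF _ c] by (force simp: T_def)
  moreover have "\<forall>\<^sub>F n in sequentially. 0 < T n"
    using \<rho>(2) by (auto simp: T_def filterlim_at_top_dense)
  ultimately have "\<forall>\<^sub>F n in sequentially. False"
  proof eventually_elim
    case (elim n)
    have "T n \<le> \<alpha> * T n / real k + \<beta> (map \<rho> [0..<n])"
      using fair k lists[of n] \<rho>(3)[of n] unfolding fair_def T_def by metis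
    also have "\<alpha> * T n / real k = (1 - 2 * c) * T n"
      using k by (simp add: c_def field_simps)
    finally have "c * T n \<le> 0" using elim by (simp add: algebra_simps)
    with c elim show False by (simp add: mult_le_0_iff)
  qed
  then show False by simp
qed

theorem theorem14:
  "(\<forall>(k::nat) (P::'p set) d A.
      0 < k \<and> uniform_metric P d \<and> (infinite P \<or> k < card P) \<and> is_LRU k P A \<longrightarrow>
      (\<exists>\<rho>::nat \<Rightarrow> 'p. range \<rho> \<subseteq> P \<and>
         filterlim (\<lambda>n. total_cost k d A (map \<rho> [0..<n])) at_top sequentially \<and>
         (\<exists>i<k.
            (\<lambda>n. server_cost d A i (map \<rho> [0..<n])) \<in> \<Omega>(\<lambda>n. total_cost k d A (map \<rho> [0..<n])) \<and>
            (\<forall>j<k. j \<noteq> i \<longrightarrow> (\<lambda>n. server_cost d A j (map \<rho> [0..<n])) \<in> O(\<lambda>_. 1)))))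
   \<and>
   (\<forall>\<alpha>::nat \<Rightarrow> real. \<alpha> \<in> o(\<lambda>k. real k) \<longrightarrow>
      (\<forall>\<^sub>F k in sequentially. \<forall>(P::'p set) d A \<beta>.
         uniform_metric P d \<and> (infinite P \<or> k < card P) \<and> is_LRU k P A \<and>
         \<beta> \<in> o[growing_cost k P d A](total_cost k d A) \<longrightarrow>
         \<not> fair k P d A (\<alpha> k) \<beta>))"
proof (intro conjI allI impI)
  fix k and P :: "'p set" and d A
  assume *: "0 < k \<and> uniform_metric P d \<and> (infinite P \<or> k < card P) \<and> is_LRU k P A"
  obtain \<rho> where "range \<rho> \<subseteq> P"
    "filterlim (\<lambda>n. total_cost k d A (map \<rho> [0..<n])) at_top sequentially"
    "\<And>n. server_cost d A 0 (map \<rho> [0..<n]) = total_cost k d A (map \<rho> [0..<n])"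
    "\<And>j n. 0 < j \<Longrightarrow> j < k \<Longrightarrow> server_cost d A j (map \<rho> [0..<n]) = 0"
    using * LRU_single_server_pays[of k P d A] by metis
  then show "\<exists>\<rho>::nat \<Rightarrow> 'p. range \<rho> \<subseteq> P \<and>
         filterlim (\<lambda>n. total_cost k d A (map \<rho> [0..<n])) at_top sequentially \<and>
         (\<exists>i<k.
            (\<lambda>n. server_cost d A i (map \<rho> [0..<n])) \<in> \<Omega>(\<lambda>n. total_cost k d A (map \<rho> [0..<n])) \<and>
            (\<forall>j<k. j \<noteq> i \<longrightarrow> (\<lambda>n. server_cost d A j (map \<rho> [0..<n])) \<in> O(\<lambda>_. 1)))"
    using * by (intro exI[of _ \<rho>] conjI exI[of _ 0]) simp_all
next
  fix \<alpha> :: "nat \<Rightarrow> real"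
  assume "\<alpha> \<in> o(\<lambda>k. real k)"
  \<comment> \<open>Any constant below 1 would do; it yields \<open>\<alpha> k < k\<close> for large
    \<open>k\<close>.\<close>
  then have "\<forall>\<^sub>F k in sequentially. \<bar>\<alpha> k\<bar> \<le> 1 / 2 * real k"
    using landau_o.smallD[of \<alpha> sequentially real "1 / 2"] by simp
  then show "\<forall>\<^sub>F k in sequentially. \<forall>(P::'p set) d A \<beta>.
         uniform_metric P d \<and> (infinite P \<or> k < card P) \<and> is_LRU k P A \<and>
         \<beta> \<in> o[growing_cost k P d A](total_cost k d A) \<longrightarrow>
         \<not> fair k P d A (\<alpha> k) \<beta>"
    using eventually_gt_at_top[of 0]
  proof eventually_elim
    case (elim k)
    then have "\<alpha> k < real k" by linarith
    with elim(2) show ?case using LRU_not_fair by blast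
  qed
qed

end
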